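(* For any positive integer $n$, the alternating group $A_n$ is good, and the symmetric group $S_n$ is good.
   Context: A finite conjugacy class $C$ of a group $G$ is good in $G$ if for every $c\in C$ there is $z\in C$ such that $\langle c\rangle\cap C_G(z)\leq Z(\langle C\rangle)$, where $\langle C\rangle$ is the subgroup of $G$ generated by $C$, $C_G(z)$ is the centralizer of $z$ in $G$, and $Z(\cdot)$ denotes the center. A group $G$ is good if all of its finite conjugacy classes are good in $G$. *)

theory Defs
  imports "HOL-Algebra.Sym_Groups"
begin

definition conjugacy_class :: "('a, 'b) monoid_scheme \<Rightarrow> 'a \<Rightarrow> 'a set" where
  "conjugacy_class G x = {g \<otimes>\<^bsub>G\<^esub> x \<otimes>\<^bsub>G\<^esub> inv\<^bsub>G\<^esub> g | g. g \<in> carrier G}"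

definition conjugacy_classes :: "('a, 'b) monoid_scheme \<Rightarrow> 'a set set" where
  "conjugacy_classes G = conjugacy_class G ` carrier G"

definition centralizer :: "('a, 'b) monoid_scheme \<Rightarrow> 'a \<Rightarrow> 'a set" where
  "centralizer G z = {g \<in> carrier G. g \<otimes>\<^bsub>G\<^esub> z = z \<otimes>\<^bsub>G\<^esub> g}"

definition group_center :: "('a, 'b) monoid_scheme \<Rightarrow> 'a set" where
  "group_center G = {z \<in> carrier G. \<forall>g \<in> carrier G. z \<otimes>\<^bsub>G\<^esub> g = g \<otimes>\<^bsub>G\<^esub> z}"

text \<open>The center is that of the subgroup generated by \<open>C\<close>, regarded as a group in its
  own right; the centralizer is taken in the whole group \<open>G\<close>.\<close>

definition good_class :: "('a, 'b) monoid_scheme \<Rightarrow> 'a set \<Rightarrow> bool" where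
  "good_class G C \<longleftrightarrow>
     C \<in> conjugacy_classes G \<and> finite C \<and>
     (\<forall>c \<in> C. \<exists>z \<in> C.
        generate G {c} \<inter> centralizer G z \<subseteq> group_center (G \<lparr> carrier := generate G C \<rparr>))"

definition good_group :: "('a, 'b) monoid_scheme \<Rightarrow> bool" where
  "good_group G \<longleftrightarrow>
     group G \<and> (\<forall>C \<in> conjugacy_classes G. finite C \<longrightarrow> good_class G C)"

end

theory Submission
  imports Defs "HOL-Combinatorics.Orbits" "HOL-Algebra.Multiplicative_Group"
begin

text \<open>Outside a few small cases, every \<open>c\<close> has a conjugate \<open>z = g c g\<^sup>-\<^sup>1\<close>, with \<open>g\<close> even, that
  commutes with no nontrivial power \<open>d\<close> of \<open>c\<close>. The main choice of \<open>g\<close> is a cycle through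
  representatives of the nontrivial orbits of \<open>c\<close>: each orbit of \<open>z\<close> then links two consecutive orbits
  of \<open>c\<close>, so that a \<open>d\<close> commuting with \<open>z\<close> is trivial as soon as it fixes one representative \<open>r\<close>.
  This holds if \<open>r\<close> is a fixed point of \<open>c\<close> (added to the list), and also if its orbit has at least
  three points and is not the only orbit. The parity of \<open>g\<close> is adjusted by a transposition inside an
  orbit of \<open>c\<close>, which does not change the orbits of \<open>z\<close>. Three-cycles settle the remaining
  cases of a single orbit and of a fixed-point-free involution. In the exceptions (no fixed points and
  \<open>n \<le> 3\<close>, or double transpositions for \<open>n = 4\<close>) the class commutes elementwise, so it generates an
  abelian group.\<close>

section \<open>Orbits of commuting and conjugate permutations\<close>

lemma orbit_eq_if_mem:
  assumes "permutation f" "y \<in> orbit f x"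
  shows "orbit f y = orbit f x"
  using assms by (metis orbit_trans orbit_swap permutation_self_in_orbit subset_antisym subsetI)

lemma mem_orbit_commute:
  assumes "d \<circ> f = f \<circ> d" "y \<in> orbit f x"
  shows "d y \<in> orbit f (d x)"
  using assms(2)
proof induction
  case base
  then show ?case using orbit.base[of f "d x"] assms(1) by (metis comp_apply)
next
  case (step y)
  then show ?case using orbit.step[OF step.IH] assms(1) by (metis comp_apply)
qed

lemma fixed_on_orbit:
  assumes "d \<circ> f = f \<circ> d" "d x = x" "y \<in> orbit f x"
  shows "d y = y"
  using assms(3)
proof induction
  case base
  then show ?case using assms(1,2) by (metis comp_apply)
next
  case (step y)
  then show ?case using assms(1) by (metis comp_apply)
qed

lemma orbit_conj:
  assumes "z \<circ> h = h \<circ> c"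
  shows "orbit z (h a) = h ` orbit c a"
proof
  show "orbit z (h a) \<subseteq> h ` orbit c a"
  proof
    fix y assume "y \<in> orbit z (h a)"
    then show "y \<in> h ` orbit c a"
    proof induction
      case base
      show ?case using assms orbit.base[of c a] by (metis comp_apply image_eqI)
    next
      case (step y)
      then obtain b where "b \<in> orbit c a" "y = h b" by auto
      then show ?case using assms orbit.step[of b c a] by (metis comp_apply image_eqI)
    qed
  qed
  have "h b \<in> orbit z (h a)" if "b \<in> orbit c a" for b
    using that
  proof induction
    case base
    show ?case using assms orbit.base[of z "h a"] by (metis comp_apply)
  next
    case (step b)
    then show ?case using assms orbit.step[OF step.IH] by (metis comp_apply)
  qed
  then show "h ` orbit c a \<subseteq> orbit z (h a)" by blast
qed

lemma cycle_of_list_nth: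
  assumes "distinct cs" "i < length cs"
  shows "cycle_of_list cs (cs ! i) = cs ! (Suc i mod length cs)"
proof -
  have "map (cycle_of_list cs) cs = rotate1 cs"
    using cyclic_rotation[OF assms(1), of 1] by simp
  then have "cycle_of_list cs (cs ! i) = rotate1 cs ! i"
    using assms(2) by (metis nth_map)
  then show ?thesis using assms(2) by (simp add: nth_rotate1)
qed

lemma funpow_commute_self: "(c ^^ k) \<circ> c = c \<circ> (c ^^ k)"
  by (metis funpow.simps(2) funpow_Suc_right)

lemma funpow_mem_orbit:
  assumes "permutation c"
  shows "(c ^^ k) x \<in> orbit c x"
  using assms by (simp add: funpow_in_orbit permutation_self_in_orbit)

section \<open>Orbit transversals\<close>

text \<open>A list rather than a set, because its order determines the cycle
  \<open>cycle_of_list cs\<close>. The head is exempt from the last clause so that a chosen fixed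
  point of \<open>c\<close> can be inserted there; every other entry represents a nontrivial
  orbit.\<close>

definition orbit_transversal :: "('a \<Rightarrow> 'a) \<Rightarrow> 'a list \<Rightarrow> bool" where
  "orbit_transversal c cs \<longleftrightarrow> cs \<noteq> [] \<and> distinct cs \<and>
     (\<forall>r \<in> set cs. \<forall>s \<in> set cs. s \<in> orbit c r \<longrightarrow> r = s) \<and>
     (\<forall>x. c x \<noteq> x \<longrightarrow> (\<exists>r \<in> set cs. r \<in> orbit c x)) \<and>
     (\<forall>r \<in> set cs. r \<noteq> hd cs \<longrightarrow> c r \<noteq> r)"

lemma orbit_transversal_exists:
  assumes "finite S" "c permutes S" "r0 \<in> S"
  obtains cs where "orbit_transversal c cs" "hd cs = r0" "set cs \<subseteq> S"
proof -
  have perm: "permutation c" using assms permutation_permutes by blast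
  define rep where "rep = (\<lambda>x. SOME y. y \<in> orbit c x)"
  have rep_in: "rep x \<in> orbit c x" for x
    unfolding rep_def using permutation_self_in_orbit[OF perm, of x] by (rule someI)
  \<comment> \<open>The orbit of \<open>r0\<close> is left out: \<open>r0\<close> itself represents
    it.\<close>
  define M where "M = {x. c x \<noteq> x \<and> x \<notin> orbit c r0}"
  have MS: "M \<subseteq> S" unfolding M_def using assms(2) by (auto simp: permutes_def)
  have "finite (rep ` M)" using MS assms(1) finite_subset by blast
  then obtain xs where xs: "set xs = rep ` M" "distinct xs"
    using finite_distinct_list by blast
  have rep_orbit: "orbit c (rep x) = orbit c x" for x
    using orbit_eq_if_mem[OF perm rep_in] .
  have rep_not: "rep x \<notin> orbit c r0" "c (rep x) \<noteq> rep x" "r0 \<notin> orbit c (rep x)" if "x \<in> M" for x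
  proof -
    show a: "rep x \<notin> orbit c r0"
      using that rep_orbit[of x] orbit_eq_if_mem[OF perm] permutation_self_in_orbit[OF perm]
      unfolding M_def by (metis (mono_tags, lifting) mem_Collect_eq)
    show "r0 \<notin> orbit c (rep x)"
      using a orbit_eq_if_mem[OF perm] permutation_self_in_orbit[OF perm] by metis
    show "c (rep x) \<noteq> rep x"
    proof
      assume "c (rep x) = rep x"
      then have "orbit c x = {rep x}" using rep_orbit[of x] orbit_eq_singleton_iff[of c "rep x"] by metis
      then have "rep x = x" using permutation_self_in_orbit[OF perm, of x] by auto
      then show False using \<open>c (rep x) = rep x\<close> that unfolding M_def by auto
    qed
  qed
  have r0: "r0 \<notin> rep ` M" using rep_not(1) permutation_self_in_orbit[OF perm] by auto
  have repS: "rep ` M \<subseteq> S" using rep_not(2) assms(2) by (auto simp: permutes_def)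
  have "orbit_transversal c (r0 # xs)"
    unfolding orbit_transversal_def
  proof (intro conjI ballI allI impI)
    show "r0 # xs \<noteq> []" by simp
    show "distinct (r0 # xs)" using xs r0 by simp
    fix r s assume "r \<in> set (r0 # xs)" "s \<in> set (r0 # xs)" "s \<in> orbit c r"
    then consider "r = r0" "s = r0" | x where "x \<in> M" "r = r0" "s = rep x"
      | x where "x \<in> M" "s = r0" "r = rep x" | x y where "r = rep x" "s = rep y"
      using xs by auto
    then show "r = s"
    proof cases
      case (4 x y)
      then have "orbit c x = orbit c y"
        using \<open>s \<in> orbit c r\<close> rep_orbit orbit_eq_if_mem[OF perm] by metis
      then show ?thesis using 4 unfolding rep_def by simp
    qed (use rep_not \<open>s \<in> orbit c r\<close> in auto)
  next
    fix x assume "c x \<noteq> x"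
    show "\<exists>r \<in> set (r0 # xs). r \<in> orbit c x"
    proof (cases "x \<in> orbit c r0")
      case True
      then show ?thesis
        using orbit_eq_if_mem[OF perm True] permutation_self_in_orbit[OF perm] by auto
    next
      case False
      then have "x \<in> M" using \<open>c x \<noteq> x\<close> unfolding M_def by simp
      then show ?thesis using xs rep_in by auto
    qed
  next
    fix r assume "r \<in> set (r0 # xs)" "r \<noteq> hd (r0 # xs)"
    then show "c r \<noteq> r" using xs rep_not by auto
  qed
  then show ?thesis using that[of "r0 # xs"] repS xs assms(3) by simp
qed

text \<open>As \<open>d\<close> commutes with \<open>c\<close> and \<open>z\<close>, fixing one
  point makes it fix the whole orbit of that point under either map. For a moved representative
  \<open>r\<close>, the point \<open>c r\<close> is no entry of \<open>cs\<close>, so the cycle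
  fixes it and the z-orbit of the next representative contains \<open>c r\<close>. Hence fixedness
  passes from each representative back to its predecessor, and from representatives to their
  c-orbits. Describing \<open>z\<close> by its orbits alone leaves room for the later parity
  correction.\<close>

lemma commuting_power_eq_id:
  assumes perm: "permutation c" and T: "orbit_transversal c cs"
    and d: "d = c ^^ k" and dz: "d \<circ> z = z \<circ> d"
    and orb: "\<And>a. orbit z (cycle_of_list cs a) = cycle_of_list cs ` orbit c a"
    and fix0: "d (hd cs) = hd cs"
  shows "d = id"
proof -
  let ?g = "cycle_of_list cs"
  have ne: "cs \<noteq> []" and dist: "distinct cs"
    and sep: "\<And>r s. r \<in> set cs \<Longrightarrow> s \<in> set cs \<Longrightarrow> s \<in> orbit c r \<Longrightarrow> r = s"
    and cov: "\<And>x. c x \<noteq> x \<Longrightarrow> \<exists>r \<in> set cs. r \<in> orbit c x"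
    and big: "\<And>r. r \<in> set cs \<Longrightarrow> r \<noteq> hd cs \<Longrightarrow> c r \<noteq> r"
    using T unfolding orbit_transversal_def by auto
  have dc: "d \<circ> c = c \<circ> d" unfolding d by (rule funpow_commute_self)
  have fix_back: "d r = r" if r: "r \<in> set cs" "d (?g r) = ?g r" for r
  proof (cases "r = hd cs")
    case True
    then show ?thesis using fix0 by simp
  next
    case False
    have "c r \<notin> set cs" using sep[OF r(1) _ orbit.base] big[OF r(1) False] by auto
    then have "?g (c r) = c r" by (rule id_outside_supp)
    then have "c r \<in> orbit z (?g r)" using orb[of r] orbit.base[of c r] by (metis image_eqI)
    then have "d (c r) = c r" using fixed_on_orbit[OF dz r(2)] by simp
    then show ?thesis
      using fixed_on_orbit[OF dc] orbit_eq_if_mem[OF perm orbit.base[of c r]]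
        permutation_self_in_orbit[OF perm, of r] by metis
  qed
  \<comment> \<open>The descent starts at \<open>i = length cs\<close>, which the modulus turns into
    index 0, the head; it then runs backwards through the list.\<close>
  have "d (cs ! (i mod length cs)) = cs ! (i mod length cs)" if "i \<le> length cs" for i
    using that
  proof (induction rule: inc_induct)
    case base
    then show ?case using fix0 ne by (simp add: hd_conv_nth)
  next
    case (step i)
    then show ?case using fix_back[of "cs ! i"]
        cycle_of_list_nth[OF dist, of i] by simp
  qed
  then have reps: "d r = r" if "r \<in> set cs" for r
    using that by (metis in_set_conv_nth less_imp_le_nat mod_less)
  have "d x = x" for x
  proof (cases "c x = x")
    case True
    then show ?thesis unfolding d by (induction k) auto
  next
    case False
    then obtain r where "r \<in> set cs" "r \<in> orbit c x" using cov by blast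
    then show ?thesis
      using fixed_on_orbit[OF dc reps] orbit_eq_if_mem[OF perm] permutation_self_in_orbit[OF perm]
      by metis
  qed
  then show ?thesis by (simp add: fun_eq_iff)
qed

text \<open>Let \<open>r\<close> be the head and suppose \<open>d u = r\<close> with
  \<open>u\<close> different from \<open>r\<close>. The z-orbit of \<open>u\<close> meets the
  c-orbit of \<open>r\<close> in at least two points, since the cycle moves no point of that c-orbit
  except \<open>r\<close>. The z-orbit of \<open>r\<close> is the image of the c-orbit of the last
  representative and meets the c-orbit of \<open>r\<close> only in \<open>r\<close>. But
  \<open>d\<close> would map the first intersection injectively into the second.\<close>

lemma commuting_power_fixes_hd:
  assumes perm: "permutation c" and T: "orbit_transversal c cs"
    and d: "d = c ^^ k" and dz: "d \<circ> z = z \<circ> d"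
    and orb: "\<And>a. orbit z (cycle_of_list cs a) = cycle_of_list cs ` orbit c a"
    and three: "c (hd cs) \<noteq> hd cs" "c (c (hd cs)) \<noteq> hd cs"
    and two: "length cs \<ge> 2"
  shows "d (hd cs) = hd cs"
proof (rule ccontr)
  let ?g = "cycle_of_list cs"
  let ?r = "hd cs"
  assume moved: "d ?r \<noteq> ?r"
  have ne: "cs \<noteq> []" and dist: "distinct cs"
    and sep: "\<And>r s. r \<in> set cs \<Longrightarrow> s \<in> set cs \<Longrightarrow> s \<in> orbit c r \<Longrightarrow> r = s"
    using T unfolding orbit_transversal_def by auto
  have inj: "inj c" using perm permutation_bijective bij_is_inj by blast
  have bij: "bij d" using perm permutation_bijective d by (metis bij_fn)
  then obtain u where u: "d u = ?r" using bij_is_surj surjD by metis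
  have u_orbit: "?r \<in> orbit c u" using funpow_mem_orbit[OF perm, of k u] u d by simp
  have u_ne: "u \<noteq> ?r" using u moved by auto
  \<comment> \<open>A third point of the orbit besides \<open>?r\<close> and \<open>u\<close>: both
    \<open>c ?r\<close> and \<open>c (c ?r)\<close> differ from \<open>?r\<close>, and by
    injectivity they differ from each other, so one of them is not \<open>u\<close>.\<close>
  define v where "v = (if c ?r = u then c (c ?r) else c ?r)"
  have v: "v \<noteq> ?r" "v \<noteq> u" "v \<in> orbit c ?r"
    unfolding v_def using three inj orbit.base[of c ?r] orbit.step[OF orbit.base[of c ?r]] by (auto dest: injD split: if_splits)
  have uv: "v \<in> orbit c u" using v(3) orbit_eq_if_mem[OF perm u_orbit] by simp
  have u_r: "u \<in> orbit c ?r"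
    using orbit_eq_if_mem[OF perm u_orbit] permutation_self_in_orbit[OF perm, of u] by simp
  have r_in: "?r \<in> set cs" using ne by simp
  have notin: "u \<notin> set cs" "v \<notin> set cs" using sep[OF r_in] u_r v u_ne by metis+
  have "v \<in> orbit z u"
    using orb[of u] uv id_outside_supp[OF notin(1)] id_outside_supp[OF notin(2)] by (metis image_eqI)
  then have dv: "d v \<in> orbit z ?r" using mem_orbit_commute[OF dz] u by metis
  \<comment> \<open>The last entry, which the cycle sends to the head; it differs from the head
    since the list has at least two entries.\<close>
  define s where "s = cs ! (length cs - 1)"
  have s_in: "s \<in> set cs" using ne unfolding s_def by simp
  have gs: "?g s = ?r"
    using cycle_of_list_nth[OF dist, of "length cs - 1"] two ne unfolding s_def
    by (simp add: hd_conv_nth)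
  have s_ne: "s \<noteq> ?r"
    using dist two ne unfolding s_def by (simp add: hd_conv_nth nth_eq_iff_index_eq)
  obtain b where b: "b \<in> orbit c s" "d v = ?g b" using dv orb[of s] gs by auto
  have dv_r: "d v \<in> orbit c ?r"
    using funpow_mem_orbit[OF perm, of k v] orbit_eq_if_mem[OF perm v(3)] d by simp
  show False
  proof (cases "b = s")
    case True
    then have "d v = d u" using b gs u by simp
    then show False using v(2) bij by (metis bij_is_inj injD)
  next
    case False
    then have "b \<notin> set cs" using sep[OF s_in _ b(1)] by auto
    then have "b \<in> orbit c ?r" using b(2) dv_r id_outside_supp by metis
    then have "s \<in> orbit c ?r"
      using b(1) orbit_eq_if_mem[OF perm] permutation_self_in_orbit[OF perm, of s] by metis
    then show False using sep[OF r_in s_in] s_ne by simp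
  qed
qed

section \<open>Conjugates commuting with no nontrivial power\<close>

text \<open>Evenness of \<open>g\<close> lets the same conjugate serve in the alternating and in the
  symmetric group. On a finite set, natural exponents already give every element of the cyclic group
  generated by \<open>c\<close>.\<close>

definition has_separating_conj :: "'a set \<Rightarrow> ('a \<Rightarrow> 'a) \<Rightarrow> bool" where
  "has_separating_conj S c \<longleftrightarrow> (\<exists>g. g permutes S \<and> evenperm g \<and>
     (\<forall>k. (c ^^ k) \<circ> (g \<circ> c \<circ> inv' g) = (g \<circ> c \<circ> inv' g) \<circ> (c ^^ k) \<longrightarrow> c ^^ k = id))"

lemma separating_conj_transversal:
  assumes fin: "finite S" and c: "c permutes S" and u: "c u \<noteq> u" and r0: "r0 \<in> S"
    and cases: "c r0 = r0 \<or>
      (c r0 \<noteq> r0 \<and> c (c r0) \<noteq> r0 \<and> (\<exists>x. c x \<noteq> x \<and> x \<notin> orbit c r0))"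
  shows "has_separating_conj S c"
proof -
  have perm: "permutation c" using fin c permutation_permutes by blast
  obtain cs where T: "orbit_transversal c cs" and hd: "hd cs = r0" and sub: "set cs \<subseteq> S"
    using orbit_transversal_exists[OF fin c r0] .
  let ?g = "cycle_of_list cs"
  have gS: "?g permutes S" using cycle_permutes sub permutes_subset by blast
  \<comment> \<open>If the cycle is odd, a transposition of two points in one c-orbit corrects the
    sign.\<close>
  define t where "t = (if evenperm ?g then id else transpose u (c u))"
  define h where "h = ?g \<circ> t"
  define z where "z = h \<circ> c \<circ> inv' h"
  have uS: "u \<in> S" "c u \<in> S" using u c by (metis permutes_def)+
  have tS: "t permutes S" unfolding t_def using uS permutes_swap_id by auto
  have hS: "h permutes S" unfolding h_def using permutes_compose[OF tS gS] .
  have "evenperm h"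
    unfolding h_def using u permutation_of_cycle[of cs]
    by (auto simp: t_def evenperm_comp permutation_swap_id evenperm_swap)
  have zh: "z \<circ> h = h \<circ> c" unfolding z_def using permutes_inv_o(2)[OF hS] by (simp add: comp_assoc)
  have "t a \<in> orbit c a" for a
    using permutation_self_in_orbit[OF perm] orbit_eq_if_mem[OF perm orbit.base[of c u]] orbit.base[of c]
    by (auto simp: t_def transpose_def)
  then have t_orbit: "t b \<in> orbit c a" if "b \<in> orbit c a" for a b
    using that orbit_eq_if_mem[OF perm] by metis
  have tt: "t (t a) = a" for a by (simp add: t_def)
  \<comment> \<open>Since \<open>t\<close> maps each c-orbit onto itself, \<open>h\<close> and
    \<open>?g\<close> have the same image on it; thus the orbits of \<open>z\<close> are those of
    the conjugate by \<open>?g\<close> alone.\<close>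
  have orb: "orbit z (?g a) = ?g ` orbit c a" for a
  proof -
    have "b \<in> t ` orbit c a" if "b \<in> orbit c a" for b
      using imageI[of "t b" "orbit c a" t] t_orbit[OF that] by (simp add: tt)
    then have "t ` orbit c a = orbit c a" using t_orbit by blast
    moreover have "orbit c (t a) = orbit c a"
      using \<open>t a \<in> orbit c a\<close> orbit_eq_if_mem[OF perm] by blast
    moreover have "?g a = h (t a)" unfolding h_def by (simp add: tt)
    ultimately show ?thesis using orbit_conj[OF zh, of "t a"] unfolding h_def by (metis image_comp)
  qed
  have "c ^^ k = id" if dz: "(c ^^ k) \<circ> z = z \<circ> (c ^^ k)" for k
  proof (rule commuting_power_eq_id[OF perm T refl dz orb])
    show "(c ^^ k) (hd cs) = hd cs"
    proof (cases "c r0 = r0")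
      case True
      then show ?thesis unfolding hd by (induction k) auto
    next
      case False
      then obtain x where x: "c x \<noteq> x" "x \<notin> orbit c r0" and three: "c (c r0) \<noteq> r0" using cases by auto
      \<comment> \<open>The orbit of the moved point \<open>x\<close> needs a representative other
        than \<open>r0\<close>, which gives the second entry.\<close>
      have "length cs \<noteq> 1"
      proof
        assume "length cs = 1"
        then have "set cs = {r0}" using hd by (cases cs) auto
        then have "r0 \<in> orbit c x" using T x(1) unfolding orbit_transversal_def by auto
        then show False using x(2) orbit_eq_if_mem[OF perm] permutation_self_in_orbit[OF perm, of x] by metis
      qed
      moreover have "length cs \<noteq> 0" using T unfolding orbit_transversal_def by simp
      ultimately have "length cs \<ge> 2" by linarith
      then show ?thesis using commuting_power_fixes_hd[OF perm T refl dz orb] False three hd by simp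
    qed
  qed
  then show ?thesis unfolding has_separating_conj_def using hS \<open>evenperm h\<close> z_def by blast
qed


text \<open>The only powers of \<open>c\<close> are \<open>id\<close> and \<open>c\<close>, so a
  conjugate not commuting with \<open>c\<close> suffices. Five points leave room for
  \<open>p\<close>, \<open>q\<close>, \<open>r\<close> in three distinct 2-cycles of
  \<open>c\<close>; after conjugation by the 3-cycle on them, \<open>c (z p) = r\<close> while
  \<open>z (c p) = q\<close>.\<close>

lemma separating_conj_involution:
  assumes fin: "finite S" and c: "c permutes S" and n: "card S \<ge> 5"
    and inv2: "\<And>x. x \<in> S \<Longrightarrow> c (c x) = x" and fpf: "\<And>x. x \<in> S \<Longrightarrow> c x \<noteq> x"
  shows "has_separating_conj S c"
proof -
  have fresh: "\<exists>x \<in> S. x \<notin> A" if "finite A" "card A \<le> 4" for A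
    using card_mono[OF that(1), of S] n that(2) by fastforce
  obtain p where p: "p \<in> S" using fresh[of "{}"] by auto
  have "card {p, c p} \<le> 4" by (rule order_trans[OF card_insert_le_m1]) auto
  then obtain q where q: "q \<in> S" "q \<notin> {p, c p}" using fresh[of "{p, c p}"] by auto
  have "card {p, c p, q, c q} \<le> 4" using card_length[of "[p, c p, q, c q]"] by simp
  then obtain r where r: "r \<in> S" "r \<notin> {p, c p, q, c q}" using fresh[of "{p, c p, q, c q}"] by auto
  let ?cs = "[p, q, r]"
  let ?g = "cycle_of_list ?cs"
  define z where "z = ?g \<circ> c \<circ> inv' ?g"
  have gS: "?g permutes S" using cycle_permutes[of ?cs] permutes_subset[of ?g "set ?cs" S] p q r by simp
  have zg: "z (?g a) = ?g (c a)" for a unfolding z_def using permutes_inverses(2)[OF gS] by simp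
  have dist: "distinct ?cs" using q r by auto
  have out: "c p \<notin> set ?cs" "c q \<notin> set ?cs" "c r \<notin> set ?cs"
    using q r fpf[OF p] fpf[OF q(1)] fpf[OF r(1)] inv2[OF p] inv2[OF q(1)] inv2[OF r(1)] by auto
  have g: "?g p = q" "?g r = p" using dist by (auto simp: transpose_def)
  have "z (c p) = q" using zg[of "c p"] id_outside_supp[OF out(1)] inv2 p g by simp
  moreover have "z p = c r" using zg[of r] id_outside_supp[OF out(3)] g by simp
  ultimately have "c (z p) = r" "z (c p) = q" using inv2 r by simp_all
  then have ne: "c \<circ> z \<noteq> z \<circ> c" using dist by (auto simp: fun_eq_iff intro!: exI[of _ p])
  have "evenperm ?g" using dist by (simp add: evenperm_comp permutation_swap_id evenperm_swap)
  have "c ^^ k = id" if "(c ^^ k) \<circ> z = z \<circ> (c ^^ k)" for k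
  proof -
    have "c (c x) = x" for x using inv2 c by (cases "x \<in> S") (auto simp: permutes_def)
    then have "c ^^ 2 = id" by (simp add: fun_eq_iff numeral_2_eq_2)
    then have "c ^^ (2 * m) = id" for m by (simp add: funpow_mult[symmetric])
    then have "c ^^ k = id \<or> c ^^ k = c"
      by (cases "even k") (auto elim!: evenE oddE)
    then show ?thesis using ne that by auto
  qed
  then show ?thesis unfolding has_separating_conj_def using gS \<open>evenperm ?g\<close> z_def by blast
qed

text \<open>Conjugating by the 3-cycle on \<open>c p\<close>, \<open>c (c p)\<close>,
  \<open>c (c (c p))\<close> changes \<open>c\<close> at no point other than \<open>p\<close>,
  \<open>c p\<close> and \<open>c (c (c p))\<close>. A power \<open>d\<close> commuting with both
  maps preserves the set where they differ, so \<open>d p\<close> is one of these three points; the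
  last two are excluded by direct evaluation. Then \<open>d\<close> fixes \<open>p\<close> and hence
  its whole orbit.\<close>

lemma separating_conj_single_orbit:
  assumes fin: "finite S" and c: "c permutes S" and n: "card S \<ge> 4"
    and orb: "\<And>x. x \<in> S \<Longrightarrow> x \<in> orbit c p" and p: "p \<in> S"
  shows "has_separating_conj S c"
proof -
  have perm: "permutation c" using fin c permutation_permutes by blast
  have inj: "c x = c y \<longleftrightarrow> x = y" for x y using permutes_inj[OF c] by (simp add: inj_eq)
  let ?a = "c p" let ?b = "c (c p)" let ?e = "c (c (c p))"
  have cS: "c x \<in> S" if "x \<in> S" for x using c that by (simp add: permutes_in_image)
  \<comment> \<open>A c-closed set containing \<open>p\<close> contains all of \<open>S\<close>.
    Thus an early return of the orbit to \<open>p\<close> would bound \<open>card S\<close> by 3,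
    which yields the distinctness claims below.\<close>
  have closed: "S \<subseteq> A" if "p \<in> A" "\<And>x. x \<in> A \<Longrightarrow> c x \<in> A" for A
  proof
    fix x assume "x \<in> S"
    from orb[OF this] show "x \<in> A" by induction (use that in auto)
  qed
  have n1: "?a \<noteq> p"
  proof
    assume "?a = p"
    then have "S \<subseteq> {p}" by (intro closed) auto
    then show False using n card_mono[of "{p}" S] by auto
  qed
  have n2: "?b \<noteq> p"
  proof
    assume "?b = p"
    then have "S \<subseteq> set [p, c p]" by (intro closed) auto
    then have "card S \<le> 2" using card_mono[of "set [p, c p]" S] card_length[of "[p, c p]"] by simp
    then show False using n by simp
  qed
  have n3: "?e \<noteq> p"
  proof
    assume "?e = p"
    then have "S \<subseteq> set [p, c p, ?b]" by (intro closed) auto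
    then have "card S \<le> 3"
      using card_mono[of "set [p, c p, ?b]" S] card_length[of "[p, c p, ?b]"] by simp
    then show False using n by simp
  qed
  let ?cs = "[?a, ?b, ?e]"
  let ?g = "cycle_of_list ?cs"
  define z where "z = ?g \<circ> c \<circ> inv' ?g"
  have gS: "?g permutes S"
    using cycle_permutes[of ?cs] permutes_subset[of ?g "set ?cs" S] p cS by simp
  have zg: "z (?g x) = ?g (c x)" for x unfolding z_def using permutes_inverses(2)[OF gS] by simp
  have dist: "distinct ?cs" using n1 n2 n3 by (simp add: inj eq_commute)
  have "evenperm ?g" using dist by (simp add: evenperm_comp permutation_swap_id evenperm_swap)
  have g: "?g ?a = ?b" "?g ?b = ?e" "?g ?e = ?a" using dist by (auto simp: transpose_def)
  have gout: "?g x = x" if "x \<noteq> ?a" "x \<noteq> ?b" "x \<noteq> ?e" for x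
    by (rule id_outside_supp) (use that in simp)
  have zp: "z p = ?b" using zg[of p] gout[of p] n1 n2 n3 g by simp
  have zb: "z ?b = ?e" using zg[of ?a] g by simp
  have ze: "z ?e = ?a" using zg[of ?b] g by simp
  have "?g (c ?e) = c ?e" by (rule gout) (use n1 n2 n3 inj in auto)
  then have za: "z ?a = c ?e" using zg[of ?e] g by simp
  have zc: "z x = c x" if "x \<noteq> p" "x \<noteq> ?a" "x \<noteq> ?b" "x \<noteq> ?e" for x
    using zg[of x] gout[of x] gout[of "c x"] that by (auto simp: inj)
  have "c ^^ k = id" if dz: "(c ^^ k) \<circ> z = z \<circ> (c ^^ k)" for k
  proof -
    define d where "d = c ^^ k"
    have comm_z: "d (z x) = z (d x)" for x using dz unfolding d_def by (metis comp_apply)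
    have dc: "d \<circ> c = c \<circ> d" unfolding d_def by (rule funpow_commute_self)
    then have comm_c: "d (c x) = c (d x)" for x by (metis comp_apply)
    have "inj d" unfolding d_def using permutes_inj[OF c] by (rule inj_fn)
    \<comment> \<open>The maps differ at \<open>p\<close>, so they differ at \<open>d p\<close> as
      well.\<close>
    have "z (d p) \<noteq> c (d p)"
    proof
      assume "z (d p) = c (d p)"
      then have "d ?b = d ?a" using comm_z[of p] zp comm_c[of p] by simp
      then show False using \<open>inj d\<close> n1 inj by (simp add: inj_eq)
    qed
    then consider "d p = p" | "d p = ?a" | "d p = ?e" using zc[of "d p"] zb by metis
    then have "d p = p"
    proof cases
      case 2
      have "d ?b = ?e" using comm_c 2 by simp
      then have "?e = c ?e" using comm_z[of p] zp za 2 by simp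
      then show ?thesis using n1 inj by metis
    next
      case 3
      have "d ?b = c (c ?e)" using comm_c 3 by simp
      \<comment> \<open>So \<open>c\<close> would be a 4-cycle on \<open>S\<close>; comparing the
        two maps at \<open>?a\<close> refutes this too.\<close>
      then have "c ?e = p" using comm_z[of p] zp ze 3 inj by simp
      then have "d (z ?a) = ?e" using za 3 by simp
      moreover have "z (d ?a) = ?b" using comm_c[of p] 3 \<open>c ?e = p\<close> zp by simp
      ultimately have "?e = ?b" using comm_z[of ?a] by simp
      then show ?thesis using n1 inj by metis
    qed
    have "d x = x" for x
    proof (cases "x \<in> S")
      case True
      then show ?thesis using fixed_on_orbit[OF dc \<open>d p = p\<close> orb] by simp
    next
      case False
      then have "c x = x" using c by (simp add: permutes_def)
      then show ?thesis unfolding d_def by (induction k) auto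
    qed
    then show ?thesis by (simp add: fun_eq_iff d_def)
  qed
  then show ?thesis unfolding has_separating_conj_def using gS \<open>evenperm ?g\<close> z_def by blast
qed

lemma separating_conj_cases:
  assumes fin: "finite S" and c: "c permutes S"
  obtains "has_separating_conj S c"
  | "card S \<le> 3" "\<And>x. x \<in> S \<Longrightarrow> c x \<noteq> x"
  | "card S = 4" "\<And>x. x \<in> S \<Longrightarrow> c x \<noteq> x" "\<And>x. x \<in> S \<Longrightarrow> c (c x) = x"
proof (cases "c = id")
  case True
  then have "has_separating_conj S c"
    unfolding has_separating_conj_def by (intro exI[of _ id]) auto
  then show ?thesis using that(1) by blast
next
  case False
  then obtain u where u: "c u \<noteq> u" by (auto simp: fun_eq_iff)
  show ?thesis
  proof (cases "\<exists>x \<in> S. c x = x")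
    case True
    then show ?thesis using separating_conj_transversal[OF fin c u] that(1) by blast
  next
    case nofix: False
    show ?thesis
    proof (cases "\<forall>x \<in> S. c (c x) = x")
      case True
      consider "card S \<le> 3" | "card S = 4" | "card S \<ge> 5" by linarith
      then show ?thesis
        using that separating_conj_involution[OF fin c] nofix True by cases auto
    next
      case False
      then obtain r where r: "r \<in> S" "c (c r) \<noteq> r" by blast
      show ?thesis
      proof (cases "\<forall>x \<in> S. x \<in> orbit c r")
        case True
        have "card S \<le> 3 \<or> card S \<ge> 4" by linarith
        then show ?thesis
          using that(1,2) separating_conj_single_orbit[OF fin c, of r] True nofix r(1) by blast
      next
        case False
        \<comment> \<open>A point of \<open>S\<close> outside the orbit of \<open>r\<close> is
          moved, as \<open>c\<close> has no fixed points in \<open>S\<close>; this supplies the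
          second nontrivial orbit.\<close>
        then show ?thesis
          using separating_conj_transversal[OF fin c u r(1)] r nofix that(1) by blast
      qed
    qed
  qed
qed

section \<open>Small degrees, where the exceptional permutations commute with each other\<close>

lemma fixed_point_free_commute_le3:
  fixes n :: nat
  assumes p: "p permutes {1..n}" "\<forall>x \<in> {1..n}. p x \<noteq> x"
    and q: "q permutes {1..n}" "\<forall>x \<in> {1..n}. q x \<noteq> x" and n: "n \<le> 3"
  shows "p \<circ> q = q \<circ> p"
proof
  fix x
  show "(p \<circ> q) x = (q \<circ> p) x"
  proof (cases "x \<in> {1..n}")
    case False
    show ?thesis using permutes_not_in[OF p(1) False] permutes_not_in[OF q(1) False] by simp
  next
    case True
    have val: "f y \<in> {1..n} - {y}"
      if "f permutes {1..n}" "\<forall>x \<in> {1..n}. f x \<noteq> x" "y \<in> {1..n}" for f y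
      using that permutes_in_image[OF that(1), of y] by blast
    have "n \<noteq> 0" using True by simp
    \<comment> \<open>One point admits no fixed-point-free permutation, two points only the swap,
      and three points only the two 3-cycles, which are mutually inverse.\<close>
    then consider "n = 1" | "n = 2" | "n = 3" using n by linarith
    then show ?thesis
    proof cases
      case 1
      then show ?thesis using val[OF p True] True by auto
    next
      case 2
      have S: "{1..n} = {1, 2}" using 2 by auto
      have "f 1 = 2 \<and> f 2 = 1" if "f permutes {1..n}" "\<forall>x \<in> {1..n}. f x \<noteq> x" for f
        using val[OF that, of 1] val[OF that, of 2] unfolding S by auto
      from this[OF p] this[OF q] True show ?thesis unfolding S by auto
    next
      case 3
      have S: "{1..n} = {1, 2, 3}" using 3 by auto
      have shape: "(f 1 = 2 \<and> f 2 = 3 \<and> f 3 = 1) \<or> (f 1 = 3 \<and> f 3 = 2 \<and> f 2 = 1)"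
        if f: "f permutes {1..n}" "\<forall>x \<in> {1..n}. f x \<noteq> x" for f
      proof -
        define a b c where "a = f 1" "b = f 2" "c = f 3"
        have "a \<noteq> b" "a \<noteq> c" "b \<noteq> c"
          unfolding a_b_c_def using permutes_inj[OF f(1)] by (simp_all add: inj_eq)
        moreover have "a = 2 \<or> a = 3" "b = 1 \<or> b = 3" "c = 1 \<or> c = 2"
          unfolding a_b_c_def using val[OF f, of 1] val[OF f, of 2] val[OF f, of 3]
          unfolding S by auto
        ultimately show ?thesis unfolding a_b_c_def[symmetric] by auto
      qed
      from shape[OF p] shape[OF q] True show ?thesis unfolding S by (elim disjE) auto
    qed
  qed
qed

text \<open>These are the three double transpositions, the nontrivial elements of the Klein
  four-group, which is abelian.\<close>

lemma fixed_point_free_involutions_commute4: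
  assumes p: "p permutes {1..4::nat}" "\<forall>x \<in> {1..4}. p x \<noteq> x" "\<forall>x \<in> {1..4}. p (p x) = x"
    and q: "q permutes {1..4::nat}" "\<forall>x \<in> {1..4}. q x \<noteq> x" "\<forall>x \<in> {1..4}. q (q x) = x"
  shows "p \<circ> q = q \<circ> p"
proof
  fix x
  have S: "{1..4::nat} = {1, 2, 3, 4}" by auto
  show "(p \<circ> q) x = (q \<circ> p) x"
  proof (cases "x \<in> {1..4}")
    case False
    show ?thesis using permutes_not_in[OF p(1) False] permutes_not_in[OF q(1) False] by simp
  next
    case True
    have shape: "(f 1 = 2 \<and> f 2 = 1 \<and> f 3 = 4 \<and> f 4 = 3) \<or>
        (f 1 = 3 \<and> f 3 = 1 \<and> f 2 = 4 \<and> f 4 = 2) \<or>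
        (f 1 = 4 \<and> f 4 = 1 \<and> f 2 = 3 \<and> f 3 = 2)"
      if f: "f permutes {1..4}" "\<forall>x \<in> {1..4}. f x \<noteq> x" "\<forall>x \<in> {1..4}. f (f x) = x"
      for f :: "nat \<Rightarrow> nat"
    proof -
      define a b c d where "a = f 1" "b = f 2" "c = f 3" "d = f 4"
      have val: "f y \<in> {1..4} - {y}" if "y \<in> {1..4}" for y
        using that f(2) permutes_in_image[OF f(1), of y] by blast
      have "a = 2 \<or> a = 3 \<or> a = 4" "b = 1 \<or> b = 3 \<or> b = 4"
        "c = 1 \<or> c = 2 \<or> c = 4" "d = 1 \<or> d = 2 \<or> d = 3"
        unfolding a_b_c_d_def using val[of 1] val[of 2] val[of 3] val[of 4]
        unfolding S by auto
      moreover have swap: "f z = y \<longleftrightarrow> f y = z" if "y \<in> {1..4}" "z \<in> {1..4}" for y z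
        using f(3) that by metis
      have "b = 1 \<longleftrightarrow> a = 2" "c = 1 \<longleftrightarrow> a = 3" "d = 1 \<longleftrightarrow> a = 4"
        "c = 2 \<longleftrightarrow> b = 3" "d = 2 \<longleftrightarrow> b = 4" "d = 3 \<longleftrightarrow> c = 4"
        unfolding a_b_c_d_def by (rule swap; simp)+
      ultimately show ?thesis unfolding a_b_c_d_def[symmetric] by auto
    qed
    from shape[OF p] shape[OF q] True show ?thesis unfolding S by (elim disjE) auto
  qed
qed

section \<open>Good groups\<close>

lemma (in group) conjugacy_class_eq:
  assumes "x \<in> carrier G" "c \<in> conjugacy_class G x"
  shows "c \<in> carrier G" "conjugacy_class G c = conjugacy_class G x"
proof -
  obtain g where g: "g \<in> carrier G" "c = g \<otimes> x \<otimes> inv g"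
    using assms unfolding conjugacy_class_def by auto
  show c: "c \<in> carrier G" using g assms by simp
  have "h \<otimes> c \<otimes> inv h \<in> conjugacy_class G x" if h: "h \<in> carrier G" for h
    unfolding conjugacy_class_def
  proof (intro CollectI exI conjI)
    show "h \<otimes> c \<otimes> inv h = (h \<otimes> g) \<otimes> x \<otimes> inv (h \<otimes> g)"
      using h g assms(1) by (simp add: m_assoc inv_mult_group)
  qed (use h g in simp)
  moreover have "h \<otimes> x \<otimes> inv h \<in> conjugacy_class G c" if h: "h \<in> carrier G" for h
    unfolding conjugacy_class_def
  proof (intro CollectI exI conjI)
    have "x = inv g \<otimes> c \<otimes> g"
      unfolding g(2) using g(1) assms(1) by (simp add: m_assoc) (simp add: m_assoc[symmetric])
    then show "h \<otimes> x \<otimes> inv h = (h \<otimes> inv g) \<otimes> c \<otimes> inv (h \<otimes> inv g)"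
      using h g(1) c by (simp add: m_assoc inv_mult_group)
  qed (use h g in simp)
  ultimately show "conjugacy_class G c = conjugacy_class G x"
    by (force simp: conjugacy_class_def[of G c] conjugacy_class_def[of G x])
qed

lemma (in group) commutes_with_generate:
  assumes "K \<subseteq> carrier G" "a \<in> carrier G" "\<And>h. h \<in> K \<Longrightarrow> a \<otimes> h = h \<otimes> a"
    and "h \<in> generate G K"
  shows "a \<otimes> h = h \<otimes> a"
  using assms(4)
proof induction
  case one
  then show ?case using assms(2) by simp
next
  case (incl h)
  then show ?case by (rule assms(3))
next
  case (inv h)
  then have h: "h \<in> carrier G" using assms(1) by blast
  have "a \<otimes> inv h = inv h \<otimes> (h \<otimes> a) \<otimes> inv h"
    using h assms(2) by (simp add: m_assoc[symmetric])
  also have "\<dots> = inv h \<otimes> a" using assms(3)[OF inv, symmetric] h assms(2) by (simp add: m_assoc)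
  finally show ?case .
next
  case (eng h1 h2)
  have "h1 \<in> carrier G" "h2 \<in> carrier G" using eng.hyps generate_in_carrier[OF assms(1)] by auto
  then show ?case using eng.IH assms(2) by (metis m_assoc)
qed

text \<open>Every member of a class represents that class, so the condition can be tested element by
  element. A trivial intersection is central in any subgroup. If instead \<open>x\<close> commutes
  with all its conjugates, then all powers of \<open>x\<close> are central in the subgroup generated
  by the class, and any member, such as \<open>x\<close>, serves as \<open>z\<close>.\<close>

lemma (in group) good_groupI:
  assumes "\<And>x. x \<in> carrier G \<Longrightarrow>
    (\<exists>g \<in> carrier G. generate G {x} \<inter> centralizer G (g \<otimes> x \<otimes> inv g) \<subseteq> {\<one>}) \<or>
    (\<forall>a \<in> conjugacy_class G x. x \<otimes> a = a \<otimes> x)"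
  shows "good_group G"
  unfolding good_group_def good_class_def
proof (intro conjI ballI impI)
  show "Group.group G" by (rule group_axioms)
  fix C c assume C: "C \<in> conjugacy_classes G" and c: "c \<in> C"
  then obtain x where x: "x \<in> carrier G" "C = conjugacy_class G x"
    unfolding conjugacy_classes_def by auto
  have cG: "c \<in> carrier G" and C_eq: "C = conjugacy_class G c"
    using conjugacy_class_eq[OF x(1)] c x(2) by auto
  have CG: "C \<subseteq> carrier G" unfolding C_eq conjugacy_class_def using cG by auto
  from assms[OF cG]
  show "\<exists>z \<in> C. generate G {c} \<inter> centralizer G z \<subseteq> group_center (G\<lparr>carrier := generate G C\<rparr>)"
  proof (elim disjE bexE)
    fix g assume g: "g \<in> carrier G"
      and sub: "generate G {c} \<inter> centralizer G (g \<otimes> c \<otimes> inv g) \<subseteq> {\<one>}"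
    have "g \<otimes> c \<otimes> inv g \<in> C" unfolding C_eq conjugacy_class_def using g by blast
    moreover have "\<one> \<in> group_center (G\<lparr>carrier := generate G C\<rparr>)"
      unfolding group_center_def using generate.one[of G C] generate_in_carrier[OF CG] by auto
    ultimately show ?thesis using sub by blast
  next
    assume comm: "\<forall>a \<in> conjugacy_class G c. c \<otimes> a = a \<otimes> c"
    have c_comm: "h \<otimes> c = c \<otimes> h" if "h \<in> generate G C" for h
      using commutes_with_generate[OF CG cG _ that] comm C_eq by auto
    have "d \<in> group_center (G\<lparr>carrier := generate G C\<rparr>)" if "d \<in> generate G {c}" for d
    proof -
      have "d \<in> generate G C" using that c mono_generate[of "{c}" C] by auto
      \<comment> \<open>Generation is used a second time: \<open>h\<close> commutes with the
        generator \<open>c\<close>, hence with every element of the cyclic group it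
        generates.\<close>
      moreover have "d \<otimes> h = h \<otimes> d" if "h \<in> generate G C" for h
        using commutes_with_generate[of "{c}" h d] cG generate_in_carrier[OF CG that] c_comm[OF that]
          \<open>d \<in> generate G {c}\<close> by auto
      ultimately show ?thesis unfolding group_center_def by simp
    qed
    then show ?thesis using c by blast
  qed
qed

text \<open>Placing \<open>carrier G\<close> between the even and all permutations treats both
  families at once: the lower bound puts the even conjugator into \<open>G\<close>, and the upper
  bound lets commutation with conjugates under arbitrary permutations cover the class in
  \<open>G\<close>.\<close>

lemma good_permutation_group:
  fixes G (structure) and n :: nat
  assumes "Group.group G" and carrier: "carrier G \<subseteq> {p. p permutes {1..n}}"
    and even: "{p. p permutes {1..n} \<and> evenperm p} \<subseteq> carrier G"
    and mult: "mult G = (\<circ>)" and one: "one G = id"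
    and inv: "\<And>p. p \<in> carrier G \<Longrightarrow> inv\<^bsub>G\<^esub> p = inv' p"
  shows "good_group G"
proof -
  interpret group G by fact
  have fin: "finite (carrier G)" by (rule finite_subset[OF carrier finite_permutations]) simp
  show ?thesis
  proof (rule good_groupI)
    fix c assume c: "c \<in> carrier G"
    then have cp: "c permutes {1..n}" using carrier by blast
    have pow: "c [^] k = c ^^ k" for k :: nat
      by (induction k) (simp_all add: mult one funpow_Suc_right del: funpow.simps(2))
    have conj: "\<exists>g. g permutes {1..n} \<and> a = g \<circ> c \<circ> inv' g" if "a \<in> conjugacy_class G c" for a
      using that carrier unfolding conjugacy_class_def by (auto simp: mult inv)
    have commI: "\<forall>a \<in> conjugacy_class G c. c \<otimes> a = a \<otimes> c"
      if "\<And>g. g permutes {1..n} \<Longrightarrow> c \<circ> (g \<circ> c \<circ> inv' g) = (g \<circ> c \<circ> inv' g) \<circ> c"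
      using conj that by (metis mult)
    \<comment> \<open>A fixed point \<open>x\<close> of the conjugate would give the fixed point
      \<open>inv' g x\<close> of \<open>c\<close>.\<close>
    have conj_fpf: "(g \<circ> c \<circ> inv' g) x \<noteq> x"
      if "\<And>x. x \<in> {1..n} \<Longrightarrow> c x \<noteq> x" "g permutes {1..n}" "x \<in> {1..n}" for g x
      using that(1)[of "inv' g x"] that(2,3) permutes_inv[OF that(2)]
      by (metis comp_apply permutes_in_image permutes_inverses(2))
    have conj_perm: "(g \<circ> c \<circ> inv' g) permutes {1..n}" if "g permutes {1..n}" for g
      using that cp by (simp add: permutes_compose permutes_inv)
    have "finite {1..n}" by simp
    then show "(\<exists>g \<in> carrier G. generate G {c} \<inter> centralizer G (g \<otimes> c \<otimes> inv g) \<subseteq> {\<one>}) \<or>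
      (\<forall>a \<in> conjugacy_class G c. c \<otimes> a = a \<otimes> c)"
    proof (cases rule: separating_conj_cases[OF _ cp, consumes 1])
      case 1
      then obtain g where g: "g permutes {1..n}" "evenperm g"
        "\<And>k. (c ^^ k) \<circ> (g \<circ> c \<circ> inv' g) = (g \<circ> c \<circ> inv' g) \<circ> (c ^^ k) \<Longrightarrow> c ^^ k = id"
        unfolding has_separating_conj_def by auto
      have gG: "g \<in> carrier G" using g even by blast
      have "generate G {c} \<inter> centralizer G (g \<otimes> c \<otimes> inv g) \<subseteq> {\<one>}"
        unfolding generate_pow_on_finite_carrier[OF fin c] centralizer_def mult inv[OF gG] one pow
        using g(3) by auto
      then show ?thesis using gG by blast
    next
      case 2
      have "c \<circ> (g \<circ> c \<circ> inv' g) = (g \<circ> c \<circ> inv' g) \<circ> c" if g: "g permutes {1..n}" for g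
      proof (rule fixed_point_free_commute_le3[OF cp _ conj_perm[OF g]])
        show "\<forall>x \<in> {1..n}. c x \<noteq> x" using 2(2) by blast
        show "\<forall>x \<in> {1..n}. (g \<circ> c \<circ> inv' g) x \<noteq> x" using conj_fpf[OF 2(2) g] by blast
        show "n \<le> 3" using 2(1) by simp
      qed
      from commI[OF this] show ?thesis by blast
    next
      case 3
      have n: "n = 4" using 3(1) by simp
      have "c \<circ> (g \<circ> c \<circ> inv' g) = (g \<circ> c \<circ> inv' g) \<circ> c" if g: "g permutes {1..n}" for g
      proof (rule fixed_point_free_involutions_commute4)
        show "c permutes {1..4}" "(g \<circ> c \<circ> inv' g) permutes {1..4}"
          using cp conj_perm[OF g] unfolding n .
        show "\<forall>x \<in> {1..4}. c x \<noteq> x" "\<forall>x \<in> {1..4}. c (c x) = x" using 3(2,3) unfolding n by blast+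
        show "\<forall>x \<in> {1..4}. (g \<circ> c \<circ> inv' g) x \<noteq> x" using conj_fpf[OF 3(2) g] unfolding n by blast
        show "\<forall>x \<in> {1..4}. (g \<circ> c \<circ> inv' g) ((g \<circ> c \<circ> inv' g) x) = x"
        proof
          fix x :: nat assume "x \<in> {1..4}"
          then have "inv' g x \<in> {1..n}" using permutes_in_image[OF permutes_inv[OF g], of x] n by blast
          from 3(3)[OF this] show "(g \<circ> c \<circ> inv' g) ((g \<circ> c \<circ> inv' g) x) = x"
            by (simp only: comp_apply permutes_inverses[OF g])
        qed
      qed
      from commI[OF this] show ?thesis by blast
    qed
  qed
qed

theorem theorem5p1:
  fixes n :: nat
  assumes "n \<ge> 1"
  shows "good_group (alt_group n) \<and> good_group (sym_group n)"
proof
  show "good_group (alt_group n)"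
  proof (rule good_permutation_group[OF alt_group_is_group])
    show "carrier (alt_group n) \<subseteq> {p. p permutes {1..n}}"
      "{p. p permutes {1..n} \<and> evenperm p} \<subseteq> carrier (alt_group n)"
      using alt_group_carrier by blast+
  qed (rule alt_group_mult alt_group_one alt_group_inv_equality, assumption?)+
  show "good_group (sym_group n)"
  proof (rule good_permutation_group[OF sym_group_is_group])
    show "carrier (sym_group n) \<subseteq> {p. p permutes {1..n}}"
      "{p. p permutes {1..n} \<and> evenperm p} \<subseteq> carrier (sym_group n)"
      using sym_group_carrier by blast+
  qed (rule sym_group_mult sym_group_one sym_group_inv_equality, assumption?)+
qed

end
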